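(* For every graph $G$ the following are equivalent: (i) every induced subgraph $H$ of $G$ satisfies $\tau_c(H) = \tau(H)$; (ii) $G$ contains none of $P_5$, $C_5$, $C_4$ as an induced subgraph; (iii) $G$ is chordal and contains no induced $P_5$.
   Context: All graphs are finite and simple. A vertex cover of $G$ is a set $C \subseteq V(G)$ meeting every edge; $\tau(G)$ is the minimum size of a vertex cover. A connected vertex cover of $G$ is a vertex cover $C$ such that $G[C]$ is connected (if $G$ is disconnected, $G[C]$ must have the same number of connected components as $G$); $\tau_c(G)$ is its minimum size. $P_k$ denotes the path on $k$ vertices and $C_k$ the cycle on $k$ vertices.
   Formalization: For disconnected G, G[C] must have as many components as G has components with an edge (isolated vertices are not counted), and the empty cover counts as connected; read literally the claim fails for two non-adjacent vertices, where τ = 0 but τ_c = 2. *)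

theory Defs
  imports "Graph_Theory.Graph_Theory"
begin

text \<open>
  Finite simple graphs are rendered by the locale \<^locale>\<open>graph\<close>: finite, loop-free, symmetric
  digraphs without parallel arcs. An undirected edge is a pair of opposite arcs, and the
  strongly connected components of a graph are its connected components.
\<close>

definition vertex_cover :: "('a, 'b) pre_digraph \<Rightarrow> 'a set \<Rightarrow> bool" where
  "vertex_cover G C \<longleftrightarrow> C \<subseteq> verts G \<and> (\<forall>e \<in> arcs G. tail G e \<in> C \<or> head G e \<in> C)"

definition vc_number :: "('a, 'b) pre_digraph \<Rightarrow> nat" where
  "vc_number G = (LEAST k. \<exists>C. vertex_cover G C \<and> card C = k)"

text \<open>
  Two conventions concern vertices without neighbours. The graph without vertices counts as
  connected, so the empty cover of a one-vertex graph is connected (\<^const>\<open>connected\<close> itself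
  excludes the graph without vertices). In a disconnected graph the components that are single
  vertices are not counted: if they were, every connected vertex cover would have to meet them,
  and already two non-adjacent vertices would have connected cover number 2 but cover number 0.
\<close>

definition connected_vertex_cover :: "('a, 'b) pre_digraph \<Rightarrow> 'a set \<Rightarrow> bool" where
  "connected_vertex_cover G C \<longleftrightarrow> vertex_cover G C \<and>
     (if connected G then C = {} \<or> connected (G \<restriction> C)
      else card (pre_digraph.sccs (G \<restriction> C)) = card {K \<in> pre_digraph.sccs G. arcs K \<noteq> {}})"

definition cvc_number :: "('a, 'b) pre_digraph \<Rightarrow> nat" where
  "cvc_number G = (LEAST k. \<exists>C. connected_vertex_cover G C \<and> card C = k)"

definition path_graph :: "nat \<Rightarrow> nat pair_pre_digraph" where
  "path_graph k = \<lparr> pverts = {..<k}, parcs = {(i, j). i < k \<and> j < k \<and> (j = i + 1 \<or> i = j + 1)} \<rparr>"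

text \<open>Meaningful for \<open>k \<ge> 3\<close> only.\<close>

definition cycle_graph :: "nat \<Rightarrow> nat pair_pre_digraph" where
  "cycle_graph k = \<lparr> pverts = {..<k},
     parcs = {(i, j). i < k \<and> j < k \<and> (j = (i + 1) mod k \<or> i = (j + 1) mod k)} \<rparr>"

definition contains_induced :: "('a, 'b) pre_digraph \<Rightarrow> ('c, 'd) pre_digraph \<Rightarrow> bool" where
  "contains_induced G F \<longleftrightarrow> (\<exists>H. induced_subgraph H G \<and> digraph_iso F H)"

text \<open>
  A chord of a cycle, given as a list \<open>p\<close> of arcs, is an edge between two vertices of the cycle
  that is not an edge of the cycle, in either direction. The closed walk \<open>a, b, a\<close>, which is a
  \<^const>\<open>pre_digraph.cycle\<close> in a symmetric digraph, is excluded by the length condition.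
\<close>

definition has_chord :: "('a, 'b) pre_digraph \<Rightarrow> 'b list \<Rightarrow> bool" where
  "has_chord G p \<longleftrightarrow> (\<exists>e \<in> arcs G. tail G e \<in> tail G ` set p \<and> head G e \<in> tail G ` set p \<and>
     (\<forall>c \<in> set p. {tail G c, head G c} \<noteq> {tail G e, head G e}))"

definition chordal :: "('a, 'b) pre_digraph \<Rightarrow> bool" where
  "chordal G \<longleftrightarrow> (\<forall>p. pre_digraph.cycle G p \<and> length p \<ge> 4 \<longrightarrow> has_chord G p)"

end

theory Submission
  imports Defs
begin

text \<open>
  In a \<open>(P\<^sub>5, C\<^sub>5, C\<^sub>4)\<close>-free graph, the ends \<open>a\<close>, \<open>b\<close> of an induced path \<open>a, v, b\<close> satisfy
  \<open>N(a) \<subseteq> N[v]\<close> or \<open>N(b) \<subseteq> N[v]\<close>. Among the minimum vertex covers \<open>C\<close> choose one for which the number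
  of pairs of vertices connected inside \<open>G[C]\<close> is largest. If two components of \<open>G[C]\<close> lay in the same
  component of \<open>G\<close>, some \<open>v \<notin> C\<close> would have neighbours \<open>a\<close>, \<open>b\<close> in different components of \<open>G[C]\<close>; if
  \<open>N(a) \<subseteq> N[v]\<close>, say, then \<open>C - a + v\<close> is a minimum vertex cover with more connected pairs. Conversely,
  every minimum vertex cover of \<open>P\<^sub>5\<close>, \<open>C\<^sub>5\<close>, \<open>C\<^sub>4\<close> induces an isolated vertex. A chordless cycle of
  length at least 6 contains an induced \<open>P\<^sub>5\<close>, which links freeness to chordality.
\<close>

section \<open>Induced subgraphs\<close>

lemma arcs_ends_induce: "arcs_ends (G \<restriction> S) = arcs_ends G \<inter> S \<times> S"
  by (auto simp: arcs_ends_conv image_iff)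

lemma induced_subgraph_arcs_ends:
  assumes "induced_subgraph H G"
  shows "arcs_ends H = arcs_ends G \<inter> verts H \<times> verts H"
proof -
  interpret wf_digraph G using assms by blast
  show ?thesis
    using arcs_ends_induce[of G "verts H"] induce_eq_iff_induced[OF assms] by simp
qed

lemma graph_induced_subgraph:
  assumes "graph G" "induced_subgraph H G"
  shows "graph H"
proof -
  interpret graph G by fact
  interpret H: digraph H by (rule digraphI_induced) fact
  show ?thesis
    by (rule H.graphI) (rule induced_graph_imp_symmetric[OF sym_arcs assms(2)])
qed

lemma induced_subgraph_trans:
  assumes "induced_subgraph H K" "induced_subgraph K G"
  shows "induced_subgraph H G"
proof (rule induced_subgraphI)
  show "subgraph H G"
    using assms by (auto intro: subgraph_trans)
  have "tail K = tail G" "head K = head G"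
    using assms(2) by (simp_all add: induced_subgraph_def subgraph_def compatible_def)
  moreover have "verts H \<subseteq> verts K" using assms(1) by auto
  ultimately show "arcs H = {e \<in> arcs G. tail G e \<in> verts H \<and> head G e \<in> verts H}"
    using assms by (auto simp: induced_subgraph_def)
qed

lemma contains_induced_subgraph:
  assumes "contains_induced H F" "induced_subgraph H G"
  shows "contains_induced G F"
proof -
  obtain K where "induced_subgraph K H" "digraph_iso F K"
    using assms(1) unfolding contains_induced_def by blast
  then show ?thesis
    unfolding contains_induced_def using induced_subgraph_trans[OF _ assms(2)] by blast
qed

text \<open>Without parallel arcs the arc map of an isomorphism is forced by its vertex map, so
  induced copies of \<open>F\<close> amount to injections of vertices that preserve and reflect
  adjacency.\<close>

lemma (in graph) contains_induced_iff:
  fixes F :: "'c pair_pre_digraph"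
  assumes "pair_wf_digraph F"
  shows "contains_induced G F \<longleftrightarrow>
    (\<exists>f. inj_on f (pverts F) \<and> f ` pverts F \<subseteq> verts G \<and>
      (\<forall>i\<in>pverts F. \<forall>j\<in>pverts F. f i \<rightarrow> f j \<longleftrightarrow> (i, j) \<in> parcs F))"
    (is "_ = (\<exists>f. ?emb f)")
proof
  interpret F: pair_wf_digraph F by fact
  assume "contains_induced G F"
  then obtain H hom where H: "induced_subgraph H G" "F.digraph_isomorphism hom"
    "H = app_iso hom (with_proj F)"
    by (auto simp: contains_induced_def digraph_iso_def)
  have vH: "verts H = iso_verts hom ` pverts F" using H(3) by simp
  have inj: "inj_on (iso_verts hom) (pverts F)"
    using F.digraph_isomorphism_inj_on_verts[OF H(2)] by simp
  have "arcs_ends H = (\<lambda>(u,v). (iso_verts hom u, iso_verts hom v)) ` parcs F"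
    using F.arcs_ends_app_iso_eq[OF H(2)] H(3) by simp
  then have E: "arcs_ends G \<inter> verts H \<times> verts H = (\<lambda>(u,v). (iso_verts hom u, iso_verts hom v)) ` parcs F"
    using induced_subgraph_arcs_ends[OF H(1)] by simp
  have "iso_verts hom i \<rightarrow> iso_verts hom j \<longleftrightarrow> (i, j) \<in> parcs F"
    if "i \<in> pverts F" "j \<in> pverts F" for i j
  proof -
    have "iso_verts hom i \<rightarrow> iso_verts hom j \<longleftrightarrow>
      (iso_verts hom i, iso_verts hom j) \<in> (\<lambda>(u,v). (iso_verts hom u, iso_verts hom v)) ` parcs F"
      unfolding E[symmetric] using that vH by auto
    also have "\<dots> \<longleftrightarrow> (i, j) \<in> parcs F"
    proof
      assume "(iso_verts hom i, iso_verts hom j) \<in> (\<lambda>(u,v). (iso_verts hom u, iso_verts hom v)) ` parcs F"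
      then obtain k l where "(k, l) \<in> parcs F" "iso_verts hom i = iso_verts hom k" "iso_verts hom j = iso_verts hom l"
        by auto
      then show "(i, j) \<in> parcs F"
        using inj_onD[OF inj] that F.in_arcsD1 F.in_arcsD2 by metis
    next
      assume "(i, j) \<in> parcs F"
      then show "(iso_verts hom i, iso_verts hom j) \<in> (\<lambda>(u,v). (iso_verts hom u, iso_verts hom v)) ` parcs F"
        by (rule rev_image_eqI) simp
    qed
    finally show ?thesis .
  qed
  moreover have "verts H \<subseteq> verts G" using H(1) by auto
  ultimately show "\<exists>f. ?emb f" using inj vH by blast
next
  interpret F: pair_wf_digraph F by fact
  assume "\<exists>f. ?emb f"
  then obtain f where f: "inj_on f (pverts F)" "f ` pverts F \<subseteq> verts G"
    and adj: "\<And>i j. \<lbrakk>i \<in> pverts F; j \<in> pverts F\<rbrakk> \<Longrightarrow> f i \<rightarrow> f j \<longleftrightarrow> (i, j) \<in> parcs F"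
    by blast
  define H where "H = G \<restriction> (f ` pverts F)"
  \<comment> \<open>\<open>arc_to_ends\<close> is injective on the arcs of a graph, so
    \<open>g\<close> picks the unique arc from \<open>f i\<close> to \<open>f j\<close>.\<close>
  define g where "g = (\<lambda>(i, j). the_inv_into (arcs G) (arc_to_ends G) (f i, f j))"
  \<comment> \<open>The image of an isomorphism takes its tail and head maps from this record; with
    those of \<open>G\<close> it becomes equal to \<open>H\<close> and not merely isomorphic to
    it.\<close>
  define hom where "hom = \<lparr>iso_verts = f, iso_arcs = g, iso_head = head G, iso_tail = tail G\<rparr>"
  have g: "g (i, j) \<in> arcs G \<and> tail G (g (i, j)) = f i \<and> head G (g (i, j)) = f j"
    if "(i, j) \<in> parcs F" for i j
  proof -
    have "f i \<rightarrow> f j" using adj that F.in_arcsD1 F.in_arcsD2 by blast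
    then have "(f i, f j) \<in> arc_to_ends G ` arcs G" by (simp add: arcs_ends_def)
    then have "arc_to_ends G (g (i, j)) = (f i, f j)" "g (i, j) \<in> arcs G"
      unfolding g_def using the_inv_into_into[OF inj_on_arc_to_ends]
      by (auto simp: f_the_inv_into_f[OF inj_on_arc_to_ends])
    then show ?thesis by (simp add: arc_to_ends_def)
  qed
  have "inj_on g (parcs F)"
  proof (rule inj_onI, clarify)
    fix i j k l assume A: "(i, j) \<in> parcs F" "(k, l) \<in> parcs F" "g (i, j) = g (k, l)"
    then have "f i = f k" "f j = f l" using g by metis+
    with A show "i = k \<and> j = l"
      using inj_onD[OF f(1)] F.in_arcsD1 F.in_arcsD2 by metis
  qed
  moreover have "wf_digraph (with_proj F)" by unfold_locales
  ultimately have "pre_digraph.digraph_isomorphism (with_proj F) hom"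
    using f(1) g by (auto simp: pre_digraph.digraph_isomorphism_def hom_def)
  moreover have "H = app_iso hom (with_proj F)"
  proof (rule pre_digraph.equality)
    have "e \<in> g ` parcs F" if "e \<in> arcs G" "tail G e = f i" "head G e = f j" "i \<in> pverts F" "j \<in> pverts F" for e i j
    proof -
      have "(i, j) \<in> parcs F" using adj that in_arcs_imp_in_arcs_ends[of e] by auto
      moreover from this have "g (i, j) = e"
        using that g by (auto intro: no_multi_arcs simp: arc_to_ends_def)
      ultimately show ?thesis by blast
    qed
    moreover have "g x \<in> arcs G \<and> tail G (g x) \<in> f ` pverts F \<and> head G (g x) \<in> f ` pverts F"
      if "x \<in> parcs F" for x
      using that g[of "fst x" "snd x"] F.in_arcsD1[of "fst x" "snd x"] F.in_arcsD2[of "fst x" "snd x"]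
      by simp
    ultimately have "{e \<in> arcs G. tail G e \<in> f ` pverts F \<and> head G e \<in> f ` pverts F} = g ` parcs F"
      by blast
    then show "arcs H = arcs (app_iso hom (with_proj F))"
      by (simp add: H_def hom_def)
  qed (auto simp: H_def hom_def)
  moreover have "induced_subgraph H G" unfolding H_def using f(2) by (rule induced_induce)
  ultimately show "contains_induced G F"
    unfolding contains_induced_def digraph_iso_def by blast
qed

section \<open>Forbidden induced subgraphs\<close>

lemma pair_wf_digraph_path_graph: "pair_wf_digraph (path_graph k)"
  by unfold_locales (auto simp: path_graph_def)

lemma pair_wf_digraph_cycle_graph: "pair_wf_digraph (cycle_graph k)"
  by unfold_locales (auto simp: cycle_graph_def)

lemma lessThan_4_5: "{..<4::nat} = {0, 1, 2, 3}" "{..<5::nat} = {0, 1, 2, 3, 4}"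
  by auto

context graph begin

lemma adj_commute: "u \<rightarrow> v \<longleftrightarrow> v \<rightarrow> u"
  by (rule iffI) (rule graph_symmetric, assumption)+

lemma adj_irrefl: "\<not> u \<rightarrow> u"
  by (rule notI) (rule adj_not_same)

text \<open>The embedding is indexing into the list. The hypotheses give each pair in one order
  only; the instances of \<open>adj_commute\<close> rewrite the opposite order into it.\<close>

lemma contains_path_graph_5I:
  assumes "distinct [a, b, c, d, e]" "a \<rightarrow> b" "b \<rightarrow> c" "c \<rightarrow> d" "d \<rightarrow> e"
    "\<not> a \<rightarrow> c" "\<not> a \<rightarrow> d" "\<not> a \<rightarrow> e" "\<not> b \<rightarrow> d" "\<not> b \<rightarrow> e" "\<not> c \<rightarrow> e"
  shows "contains_induced G (path_graph 5)"
proof -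
  have "{a, b, c, d, e} \<subseteq> verts G" using assms by (auto dest: adj_in_verts)
  then show ?thesis
    unfolding contains_induced_iff[OF pair_wf_digraph_path_graph]
    using assms adj_irrefl adj_commute[of b a] adj_commute[of c a] adj_commute[of d a] adj_commute[of e a] adj_commute[of c b] adj_commute[of d b] adj_commute[of e b] adj_commute[of d c] adj_commute[of e c] adj_commute[of e d]
    by (intro exI[of _ "(!) [a, b, c, d, e]"] conjI inj_on_nth)
      (simp_all add: path_graph_def lessThan_4_5)
qed

lemma contains_cycle_graph_5I:
  assumes "distinct [a, b, c, d, e]" "a \<rightarrow> b" "b \<rightarrow> c" "c \<rightarrow> d" "d \<rightarrow> e" "e \<rightarrow> a"
    "\<not> a \<rightarrow> c" "\<not> a \<rightarrow> d" "\<not> b \<rightarrow> d" "\<not> b \<rightarrow> e" "\<not> c \<rightarrow> e"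
  shows "contains_induced G (cycle_graph 5)"
proof -
  have "{a, b, c, d, e} \<subseteq> verts G" using assms by (auto dest: adj_in_verts)
  then show ?thesis
    unfolding contains_induced_iff[OF pair_wf_digraph_cycle_graph]
    using assms adj_irrefl adj_commute[of b a] adj_commute[of c a] adj_commute[of d a] adj_commute[of e a] adj_commute[of c b] adj_commute[of d b] adj_commute[of e b] adj_commute[of d c] adj_commute[of e c] adj_commute[of e d]
    by (intro exI[of _ "(!) [a, b, c, d, e]"] conjI inj_on_nth)
      (simp_all add: cycle_graph_def lessThan_4_5)
qed

lemma contains_cycle_graph_4I:
  assumes "distinct [a, b, c, d]" "a \<rightarrow> b" "b \<rightarrow> c" "c \<rightarrow> d" "d \<rightarrow> a"
    "\<not> a \<rightarrow> c" "\<not> b \<rightarrow> d"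
  shows "contains_induced G (cycle_graph 4)"
proof -
  have "{a, b, c, d} \<subseteq> verts G" using assms by (auto dest: adj_in_verts)
  then show ?thesis
    unfolding contains_induced_iff[OF pair_wf_digraph_cycle_graph]
    using assms adj_irrefl adj_commute[of b a] adj_commute[of c a] adj_commute[of d a] adj_commute[of c b] adj_commute[of d b] adj_commute[of d c]
    by (intro exI[of _ "(!) [a, b, c, d]"] conjI inj_on_nth)
      (simp_all add: cycle_graph_def lessThan_4_5)
qed

text \<open>The private neighbours of \<open>a\<close> and \<open>b\<close> would otherwise complete \<open>a, v, b\<close> to a forbidden subgraph.\<close>

lemma neighbourhood_dominated:
  assumes free: "\<not> contains_induced G (path_graph 5)" "\<not> contains_induced G (cycle_graph 5)"
      "\<not> contains_induced G (cycle_graph 4)"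
    and avb: "a \<rightarrow> v" "v \<rightarrow> b" "a \<noteq> b" "\<not> a \<rightarrow> b"
  shows "(\<forall>y. a \<rightarrow> y \<longrightarrow> y = v \<or> y \<rightarrow> v) \<or> (\<forall>z. b \<rightarrow> z \<longrightarrow> z = v \<or> z \<rightarrow> v)"
proof (rule ccontr)
  assume "\<not> ?thesis"
  then obtain y z where y: "a \<rightarrow> y" "y \<noteq> v" "\<not> y \<rightarrow> v" and z: "b \<rightarrow> z" "z \<noteq> v" "\<not> z \<rightarrow> v"
    by blast
  have "a \<noteq> v" "b \<noteq> v" "y \<noteq> a" "z \<noteq> b" "y \<noteq> b" "z \<noteq> a"
    using avb y z adj_irrefl adj_commute by metis+
  note neq = this avb(3) y(2) z(2)
  have sym: "y \<rightarrow> a" "v \<rightarrow> a" "b \<rightarrow> v" "z \<rightarrow> b" "\<not> b \<rightarrow> a"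
    using avb y z adj_commute by metis+
  \<comment> \<open>An edge between \<open>y\<close> and \<open>b\<close> would complete the induced
    4-cycle \<open>y, a, v, b\<close>; an edge between \<open>z\<close> and \<open>a\<close> is
    excluded symmetrically.\<close>
  have yb: "\<not> y \<rightarrow> b"
  proof
    assume "y \<rightarrow> b"
    then have "b \<rightarrow> y" using adj_commute by metis
    from contains_cycle_graph_4I[OF _ sym(1) avb(1,2) this y(3) avb(4)] neq free(3)
    show False by simp
  qed
  have za: "\<not> z \<rightarrow> a"
  proof
    assume "z \<rightarrow> a"
    then have "a \<rightarrow> z" using adj_commute by metis
    from contains_cycle_graph_4I[OF _ sym(4,3,2) this z(3) sym(5)] neq free(3)
    show False by simp
  qed
  have "y \<noteq> z" using y z za adj_commute by metis
  then have d: "distinct [y, a, v, b, z]" using neq by auto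
  have e: "y \<rightarrow> a" "\<not> a \<rightarrow> z" "\<not> v \<rightarrow> z" using y z za adj_commute by metis+
  show False
  \<comment> \<open>In \<open>y, a, v, b, z\<close> only the adjacency of the two ends is still
    open: an edge yields an induced 5-cycle, a non-edge an induced path.\<close>
  proof (cases "y \<rightarrow> z")
    case True
    then have "z \<rightarrow> y" using adj_commute by metis
    from contains_cycle_graph_5I[OF d e(1) avb(1,2) z(1) this y(3) yb avb(4) e(2,3)] free(2)
    show False by contradiction
  next
    case False
    from contains_path_graph_5I[OF d e(1) avb(1,2) z(1) y(3) yb False avb(4) e(2,3)] free(1)
    show False by contradiction
  qed
qed

end


section \<open>Chordal graphs\<close>

context graph begin

lemma cas_nth_Suc:
  assumes "cas u p v" "Suc i < length p"
  shows "head G (p ! i) = tail G (p ! Suc i)"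
  using assms
proof (induction p arbitrary: u i)
  case (Cons e es)
  show ?case
  proof (cases i)
    case 0
    then show ?thesis using Cons.prems by (cases es) auto
  next
    case (Suc j)
    then show ?thesis using Cons by auto
  qed
qed simp

text \<open>Turns a \<open>cycle\<close>, a closed walk given by its arcs, into a cyclic sequence of
  distinct vertices with indices modulo the length.\<close>

lemma cycle_tails:
  assumes "cycle p"
  shows "set p \<subseteq> arcs G" "distinct (map (tail G) p)"
    "i < length p \<Longrightarrow> head G (p ! i) = tail G (p ! (Suc i mod length p))"
proof -
  obtain u where w: "awalk u p u" and d: "distinct (tl (awalk_verts u p))" and ne: "p \<noteq> []"
    using assms unfolding cycle_def by metis
  then have cas: "cas u p u" and "set p \<subseteq> arcs G" by (simp_all add: awalk_def)
  from this(2) show "set p \<subseteq> arcs G" .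
  have hd: "tail G (hd p) = u" using cas ne cas_simp by metis
  have "awlast u p = u" using cas by (rule awlast_if_cas)
  then have last: "head G (last p) = u" using ne by (simp add: awalk_verts_conv)
  \<comment> \<open>The closed walk lists \<open>u\<close> at both ends; dropping the first
    occurrence leaves the tails rotated by one place, so distinctness carries over.\<close>
  have "tl (awalk_verts u p) = map (tail G) (tl p) @ [u]"
    using ne last by (simp add: awalk_verts_conv map_tl)
  moreover have "map (tail G) p = u # map (tail G) (tl p)"
    using ne hd by (cases p) simp_all
  ultimately show "distinct (map (tail G) p)" using d by simp
  assume i: "i < length p"
  show "head G (p ! i) = tail G (p ! (Suc i mod length p))"
  proof (cases "Suc i < length p")
    case True
    then show ?thesis using cas_nth_Suc[OF cas] by simp
  next
    case False
    then have "Suc i = length p" using i by simp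
    then show ?thesis
      using hd last ne by (metis diff_Suc_1 hd_conv_nth last_conv_nth mod_self)
  qed
qed

text \<open>An edge between vertices of the cycle that is not a chord has the same ends as some arc
  of the cycle, and distinctness of the tails turns equal ends into equal indices. Conversely, each
  arc of the cycle joins consecutive tails.\<close>

lemma chordless_cycle_adj:
  assumes p: "cycle p" "\<not> has_chord G p" and ij: "i < length p" "j < length p"
  shows "tail G (p ! i) \<rightarrow> tail G (p ! j) \<longleftrightarrow> j = Suc i mod length p \<or> i = Suc j mod length p"
proof
  note nth = cycle_tails(3)[OF p(1)]
  have idx: "a = b" if "a < length p" "b < length p" "tail G (p ! a) = tail G (p ! b)" for a b
    using cycle_tails(2)[OF p(1)] that by (metis length_map nth_eq_iff_index_eq nth_map)
  have arc: "p ! m \<in> arcs G" if "m < length p" for m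
    using cycle_tails(1)[OF p(1)] that by (metis nth_mem subsetD)
  have mod: "Suc m mod length p < length p" for m
    using ij(1) by (intro mod_less_divisor) linarith
  {
    assume "tail G (p ! i) \<rightarrow> tail G (p ! j)"
    then obtain e where e: "e \<in> arcs G" "tail G e = tail G (p ! i)" "head G e = tail G (p ! j)"
      by (rule reachableE)
    have "tail G e \<in> tail G ` set p" "head G e \<in> tail G ` set p"
      using e ij by simp_all
    then obtain c where "c \<in> set p" "{tail G c, head G c} = {tail G e, head G e}"
      using p(2) e(1) unfolding has_chord_def by metis
    then obtain m where m: "m < length p" "{tail G (p ! m), head G (p ! m)} = {tail G e, head G e}"
      by (metis in_set_conv_nth)
    then have "tail G (p ! m) = tail G (p ! i) \<and> tail G (p ! (Suc m mod length p)) = tail G (p ! j) \<or>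
        tail G (p ! m) = tail G (p ! j) \<and> tail G (p ! (Suc m mod length p)) = tail G (p ! i)"
      using nth e by (simp add: doubleton_eq_iff)
    then show "j = Suc i mod length p \<or> i = Suc j mod length p"
      using idx m(1) mod ij by metis
  }
  have adj: "tail G (p ! m) \<rightarrow> tail G (p ! (Suc m mod length p))" if "m < length p" for m
    using in_arcs_imp_in_arcs_ends[OF arc[OF that]] nth[OF that] by simp
  assume "j = Suc i mod length p \<or> i = Suc j mod length p"
  then show "tail G (p ! i) \<rightarrow> tail G (p ! j)"
    using adj ij adj_commute by metis
qed

text \<open>The tails of a chordless cycle of length \<open>n\<close> form an induced copy of
  \<open>cycle_graph n\<close>. Lengths 4 and 5 are forbidden directly, longer ones through an
  induced path.\<close>

lemma chordal_if_free:
  assumes free: "\<not> contains_induced G (path_graph 5)" "\<not> contains_induced G (cycle_graph 5)"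
      "\<not> contains_induced G (cycle_graph 4)"
  shows "chordal G"
  unfolding chordal_def
proof (intro allI impI, elim conjE, rule ccontr)
  fix p assume p: "cycle p" "4 \<le> length p" "\<not> has_chord G p"
  define f where "f i = tail G (p ! i)" for i
  have inj: "inj_on f {..<length p}"
    using cycle_tails(2)[OF p(1)] unfolding f_def inj_on_def
    by (metis length_map lessThan_iff nth_eq_iff_index_eq nth_map)
  have verts: "f ` {..<length p} \<subseteq> verts G"
  proof
    fix x assume "x \<in> f ` {..<length p}"
    then obtain i where "i < length p" "x = f i" by blast
    then show "x \<in> verts G"
      using cycle_tails(1)[OF p(1)] unfolding f_def by (metis nth_mem subsetD tail_in_verts)
  qed
  have adj: "f i \<rightarrow> f j \<longleftrightarrow> j = Suc i mod length p \<or> i = Suc j mod length p"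
    if "i < length p" "j < length p" for i j
    unfolding f_def using chordless_cycle_adj[OF p(1,3) that] .
  have "contains_induced G (cycle_graph (length p))"
    unfolding contains_induced_iff[OF pair_wf_digraph_cycle_graph]
    by (rule exI[of _ f]) (simp add: cycle_graph_def inj verts adj)
  with free have "length p \<noteq> 4" "length p \<noteq> 5" by metis+
  \<comment> \<open>From length 6 on, the successor of an index below 5 does not wrap around, so the
    first five vertices of the cycle induce a path.\<close>
  with p(2) have len: "6 \<le> length p" by simp
  then have sub: "{..<5} \<subseteq> {..<length p}" by auto
  have "f i \<rightarrow> f j \<longleftrightarrow> j = i + 1 \<or> i = j + 1" if "i < 5" "j < 5" for i j
    using that len adj[of i j] by simp
  then have "contains_induced G (path_graph 5)"
    unfolding contains_induced_iff[OF pair_wf_digraph_path_graph]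
    using inj_on_subset[OF inj sub] image_mono[OF sub, of f] verts
    by (intro exI[of _ f]) (simp add: path_graph_def)
  with free(1) show False by contradiction
qed

text \<open>The arcs between cyclically consecutive vertices of the copy form a
  \<open>cycle\<close>; since the copy is induced, no further edge joins two of its
  vertices.\<close>

lemma not_chordal_if_contains_cycle_graph:
  assumes "4 \<le> k" "contains_induced G (cycle_graph k)"
  shows "\<not> chordal G"
proof -
  obtain f where inj: "inj_on f {..<k}" and verts: "f ` {..<k} \<subseteq> verts G"
    and adj: "\<And>i j. \<lbrakk>i < k; j < k\<rbrakk> \<Longrightarrow> f i \<rightarrow> f j \<longleftrightarrow> j = Suc i mod k \<or> i = Suc j mod k"
    using assms(2) unfolding contains_induced_iff[OF pair_wf_digraph_cycle_graph]
    by (auto simp: cycle_graph_def)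
  have "\<exists>e. e \<in> arcs G \<and> tail G e = f i \<and> head G e = f (Suc i mod k)" if "i < k" for i
  proof -
    have "f i \<rightarrow> f (Suc i mod k)" using adj that by simp
    then show ?thesis by (rule reachableE) blast
  qed
  then obtain g where g: "\<And>i. i < k \<Longrightarrow> g i \<in> arcs G \<and> tail G (g i) = f i \<and> head G (g i) = f (Suc i mod k)"
    by metis
  define p where "p = map g [0..<k]"
  \<comment> \<open>Stated for prefixes to allow induction; \<open>n mod k\<close> is
    \<open>n\<close> for proper prefixes and makes the full walk, with \<open>n = k\<close>, return
    to \<open>f 0\<close>.\<close>
  have "cas (f 0) (map g [0..<n]) (f (n mod k))" if "n \<le> k" for n
    using that
  proof (induction n)
    case (Suc n)
    then have "cas (f 0) (map g [0..<n]) (f n)" by simp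
    moreover from this have "awlast (f 0) (map g [0..<n]) = f n" by (rule awlast_if_cas)
    ultimately show ?case using Suc.prems g by simp
  qed simp
  then have "cas (f 0) p (f 0)" unfolding p_def by (metis mod_self order_refl)
  moreover have "set p \<subseteq> arcs G" using g by (simp add: p_def image_subset_iff)
  moreover have "f 0 \<in> verts G" using verts assms(1) by (simp add: image_subset_iff)
  ultimately have "awalk (f 0) p (f 0)" by (simp add: awalk_def)
  moreover have "distinct (tl (awalk_verts (f 0) p))"
  proof -
    have "p = g 0 # map g [1..<k]" using assms(1) by (simp add: p_def upt_conv_Cons)
    moreover from this have "awlast (f 0) p = f 0"
      using \<open>cas (f 0) p (f 0)\<close> awlast_if_cas by metis
    \<comment> \<open>The start vertex removed by \<open>tl\<close> reappears at the end, so every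
      index occurs exactly once, in the order \<open>1, ..., k - 1, 0\<close>.\<close>
    ultimately have "tl (awalk_verts (f 0) p) = map (tail G) (map g [1..<k]) @ [f 0]"
      by (simp add: awalk_verts_conv)
    also have "\<dots> = map f ([1..<k] @ [0])"
      using g by simp
    finally have "tl (awalk_verts (f 0) p) = map f ([1..<k] @ [0])" .
    moreover have "inj_on f (set ([1..<k] @ [0]))"
      using inj by (rule inj_on_subset) (use assms(1) in auto)
    ultimately show ?thesis by (simp only: distinct_map) simp
  qed
  ultimately have "cycle p" using assms(1) unfolding cycle_def p_def by (metis Nil_is_map_conv bot_nat_0.extremum_unique numeral_neq_zero upt_eq_Nil_conv)
  moreover have "length p \<ge> 4" using assms(1) by (simp add: p_def)
  moreover have "\<not> has_chord G p"
  proof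
    assume "has_chord G p"
    then obtain e where e: "e \<in> arcs G" "tail G e \<in> tail G ` set p" "head G e \<in> tail G ` set p"
      and chord: "\<And>c. c \<in> set p \<Longrightarrow> {tail G c, head G c} \<noteq> {tail G e, head G e}"
      unfolding has_chord_def by blast
    from e(2) g obtain i where i: "i < k" "tail G e = f i" unfolding p_def by auto
    from e(3) g obtain j where j: "j < k" "head G e = f j" unfolding p_def by auto
    have "f i \<rightarrow> f j" using in_arcs_imp_in_arcs_ends[OF e(1)] i j by simp
    then have "j = Suc i mod k \<or> i = Suc j mod k" using adj i j by simp
    \<comment> \<open>If \<open>j\<close> follows \<open>i\<close>, the supposed chord has the ends
      of \<open>g i\<close>; otherwise it has the ends of \<open>g j\<close>, traversed
      backwards.\<close>
    moreover have "g i \<in> set p" "g j \<in> set p" using i j by (simp_all add: p_def)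
    ultimately show False
      using chord g i j by (metis insert_commute)
  qed
  ultimately show ?thesis unfolding chordal_def by metis
qed

end


section \<open>Minimum vertex covers preserving components\<close>

context graph begin

text \<open>Reachability in \<open>G \<restriction> S\<close> is reflexive on \<open>S\<close> only,
  the closure everywhere; \<open>u \<in> S\<close> reconciles the two.\<close>

lemma reachable_induce_iff:
  assumes "u \<in> S" 
  shows "u \<rightarrow>\<^sup>*\<^bsub>G \<restriction> S\<^esub> v \<longleftrightarrow> (u, v) \<in> (arcs_ends G \<inter> S \<times> S)\<^sup>*"
proof -
  interpret S: wf_digraph "G \<restriction> S" by (rule wellformed_induce_subgraph)
  show ?thesis
    using S.reachable_conv'[of u v] assms by (simp add: arcs_ends_induce)
qed

lemma sym_induced: "sym (arcs_ends G \<inter> S \<times> S)"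
  using graph_symmetric unfolding sym_def by blast

lemma sym_induced_rtrancl: "(u, v) \<in> (arcs_ends G \<inter> S \<times> S)\<^sup>* \<Longrightarrow> (v, u) \<in> (arcs_ends G \<inter> S \<times> S)\<^sup>*"
  using sym_rtrancl[OF sym_induced] by (rule symD)

lemma vertex_cover_iff:
  "vertex_cover G C \<longleftrightarrow> C \<subseteq> verts G \<and> (\<forall>u v. u \<rightarrow> v \<longrightarrow> u \<in> C \<or> v \<in> C)"
proof -
  have "(\<forall>e\<in>arcs G. tail G e \<in> C \<or> head G e \<in> C) \<longleftrightarrow> (\<forall>u v. u \<rightarrow> v \<longrightarrow> u \<in> C \<or> v \<in> C)"
    by (force simp: arcs_ends_conv)
  then show ?thesis unfolding vertex_cover_def by metis
qed

lemma vertex_cover_verts: "vertex_cover G (verts G)"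
  by (simp add: vertex_cover_def)

lemma vc_number_le: "vertex_cover G C \<Longrightarrow> vc_number G \<le> card C"
  unfolding vc_number_def by (rule Least_le) blast

lemma minimum_vertex_cover_exists: "\<exists>C. vertex_cover G C \<and> card C = vc_number G"
proof -
  have "\<exists>k C. vertex_cover G C \<and> card C = k" using vertex_cover_verts by metis
  from LeastI_ex[OF this] show ?thesis unfolding vc_number_def .
qed

text \<open>Removing \<open>a\<close> endangers only the edges at \<open>a\<close>. A neighbour of
  \<open>a\<close> other than \<open>v\<close> is a neighbour of \<open>v\<close>, and since
  \<open>v\<close> is outside the cover \<open>C\<close>, all neighbours of \<open>v\<close> lie in
  \<open>C\<close>.\<close>

lemma swap_vertex_cover:
  assumes "vertex_cover G C" "v \<notin> C" "a \<rightarrow> v" "\<forall>y. a \<rightarrow> y \<longrightarrow> y = v \<or> y \<rightarrow> v"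
  shows "vertex_cover G (insert v (C - {a}))"
proof -
  have *: "y \<in> insert v (C - {a})" if "a \<rightarrow> y" for y
    using that assms adj_irrefl unfolding vertex_cover_iff by (metis DiffI insertI1 insertI2 singletonD)
  have "x \<in> insert v (C - {a}) \<or> y \<in> insert v (C - {a})" if "x \<rightarrow> y" for x y
  proof (cases "x = a \<or> y = a")
    case True
    then show ?thesis using * that adj_commute by metis
  next
    case False
    have "x \<in> C \<or> y \<in> C" using that assms(1) unfolding vertex_cover_iff by metis
    with False show ?thesis by (elim disjE) simp_all
  qed
  moreover have "v \<in> verts G" using assms(3) adj_in_verts by metis
  ultimately show ?thesis using assms(1) unfolding vertex_cover_iff by simp blast
qed

text \<open>The ordered pairs, diagonal included, of vertices in a common component of
  \<open>G \<restriction> C\<close>. Their number, the sum of the squared component sizes, is the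
  quantity maximised over minimum covers.\<close>

definition linked_pairs :: "'a set \<Rightarrow> ('a \<times> 'a) set" where
  "linked_pairs C = (arcs_ends G \<inter> C \<times> C)\<^sup>* \<inter> C \<times> C"

text \<open>The swap maps edges inside \<open>C\<close> to edges inside the new cover, and additionally joins \<open>v\<close> to \<open>b\<close>.\<close>

lemma swap_linked_pairs:
  assumes C: "finite C" "a \<in> C" "b \<in> C" "v \<notin> C"
    and adj: "a \<rightarrow> v" "v \<rightarrow> b" and dom: "\<forall>y. a \<rightarrow> y \<longrightarrow> y = v \<or> y \<rightarrow> v"
    and sep: "(a, b) \<notin> (arcs_ends G \<inter> C \<times> C)\<^sup>*"
  shows "card (linked_pairs C) < card (linked_pairs (insert v (C - {a})))"
proof -
  define D where "D = insert v (C - {a})"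
  define h where "h x = (if x = a then v else x)" for x
  have edge: "(h x, h y) \<in> arcs_ends G \<inter> D \<times> D" if "(x, y) \<in> arcs_ends G \<inter> C \<times> C" for x y
  proof -
    have xy: "x \<rightarrow> y" "x \<in> C" "y \<in> C" using that by simp_all
    have "x \<noteq> y" "x \<noteq> v" "y \<noteq> v" using xy C(4) adj_irrefl by metis+
    \<comment> \<open>Only edges at \<open>a\<close> are changed by \<open>h\<close>; the other end
      lies in \<open>C\<close>, hence differs from \<open>v\<close>, and \<open>dom\<close> makes it
      adjacent to \<open>v\<close>.\<close>
    have "h x \<rightarrow> h y"
      using xy dom adj_commute \<open>x \<noteq> y\<close> \<open>x \<noteq> v\<close> \<open>y \<noteq> v\<close> unfolding h_def by metis
    then show ?thesis using xy by (simp add: D_def h_def)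
  qed
  have hom: "(h x, h y) \<in> (arcs_ends G \<inter> D \<times> D)\<^sup>*" if "(x, y) \<in> (arcs_ends G \<inter> C \<times> C)\<^sup>*" for x y
    using that
  proof (induction rule: rtrancl_induct)
    case (step y z)
    then show ?case using edge[of y z]
      by (meson rtrancl.rtrancl_into_rtrancl)
  qed simp
  have inj: "inj_on h C" using C(4) unfolding h_def inj_on_def by metis
  let ?h = "map_prod h h"
  have "a \<noteq> b" using sep by auto
  have "?h ` linked_pairs C \<subset> linked_pairs D"
  proof
    show "?h ` linked_pairs C \<subseteq> linked_pairs D"
    proof (rule image_subsetI)
      fix z assume "z \<in> linked_pairs C"
      then show "?h z \<in> linked_pairs D"
        using hom[of "fst z" "snd z"] unfolding linked_pairs_def
        by (cases z) (simp add: D_def h_def)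
    qed
    have "(v, b) \<in> arcs_ends G \<inter> D \<times> D"
      using adj(2) C \<open>a \<noteq> b\<close> by (simp add: D_def)
    then have "(v, b) \<in> linked_pairs D" unfolding linked_pairs_def by blast
    \<comment> \<open>The pair gained by the swap: its preimage would be \<open>(a, b)\<close>,
      which is separated inside \<open>C\<close>.\<close>
    moreover have "(v, b) \<notin> ?h ` linked_pairs C"
    proof
      assume "(v, b) \<in> ?h ` linked_pairs C"
      then obtain x y where xy: "(x, y) \<in> linked_pairs C" "h x = v" "h y = b" by auto
      then have "x = a" "y = b"
        using C \<open>a \<noteq> b\<close> unfolding linked_pairs_def h_def by (auto split: if_splits)
      then show False using xy(1) sep by (simp add: linked_pairs_def)
    qed
    ultimately show "?h ` linked_pairs C \<noteq> linked_pairs D" by metis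
  qed
  moreover have "finite (linked_pairs D)" using C(1) by (simp add: linked_pairs_def D_def)
  ultimately have "card (?h ` linked_pairs C) < card (linked_pairs D)" by (metis psubset_card_mono)
  moreover have "inj_on ?h (linked_pairs C)"
    by (rule inj_on_subset[OF map_prod_inj_on[OF inj inj]]) (auto simp: linked_pairs_def)
  ultimately show ?thesis by (simp add: card_image D_def)
qed

text \<open>Induction along a walk from \<open>u\<close>. A walk that leaves the cover
  \<open>C\<close> must return at the next vertex, so at a vertex outside \<open>C\<close> the
  invariant speaks of all its neighbours in \<open>C\<close>; \<open>join\<close> is what links the
  vertex of departure to these.\<close>

lemma reachable_in_cover:
  assumes C: "vertex_cover G C" and u: "u \<in> C" and reach: "u \<rightarrow>\<^sup>* x"
    and join: "\<And>a v b. \<lbrakk>a \<in> C; b \<in> C; v \<notin> C; a \<rightarrow> v; v \<rightarrow> b\<rbrakk> \<Longrightarrow> (a, b) \<in> (arcs_ends G \<inter> C \<times> C)\<^sup>*"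
  shows "(x \<in> C \<longrightarrow> (u, x) \<in> (arcs_ends G \<inter> C \<times> C)\<^sup>*) \<and>
    (x \<notin> C \<longrightarrow> (\<forall>b\<in>C. x \<rightarrow> b \<longrightarrow> (u, b) \<in> (arcs_ends G \<inter> C \<times> C)\<^sup>*))"
  using reach
proof (induction rule: reachable_induct)
  case (step x y)
  consider "x \<in> C" "y \<in> C" | "x \<in> C" "y \<notin> C" | "x \<notin> C" "y \<in> C"
    using C step(2) unfolding vertex_cover_iff by metis
  then show ?case
  proof cases
    case 1
    then have "(x, y) \<in> arcs_ends G \<inter> C \<times> C" using step(2) by simp
    then show ?thesis using 1 step(3) by (metis rtrancl.rtrancl_into_rtrancl)
  next
    case 2
    then show ?thesis using join step(2,3) by (metis rtrancl_trans)
  next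
    case 3
    then show ?thesis using step(2,3) by metis
  qed
qed (use u in simp)

text \<open>The extremal argument. Its conclusion says that each component of \<open>G\<close>
  meeting \<open>C\<close> leaves a single component of \<open>G \<restriction> C\<close>.\<close>

lemma component_preserving_minimum_cover:
  assumes free: "\<not> contains_induced G (path_graph 5)" "\<not> contains_induced G (cycle_graph 5)"
      "\<not> contains_induced G (cycle_graph 4)"
  obtains C where "vertex_cover G C" "card C = vc_number G"
    "\<And>u w. \<lbrakk>u \<in> C; w \<in> C; u \<rightarrow>\<^sup>* w\<rbrakk> \<Longrightarrow> u \<rightarrow>\<^sup>*\<^bsub>G \<restriction> C\<^esub> w"
proof -
  let ?P = "\<lambda>C. vertex_cover G C \<and> card C = vc_number G"
  have fin: "finite C" if "?P C" for C
    using that finite_subset[OF _ finite_verts] unfolding vertex_cover_iff by metis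
  have bound: "card (linked_pairs C) < Suc (card (verts G \<times> verts G))" if "?P C" for C
  proof -
    have "linked_pairs C \<subseteq> verts G \<times> verts G"
      using that unfolding linked_pairs_def vertex_cover_iff by blast
    then have "card (linked_pairs C) \<le> card (verts G \<times> verts G)"
      by (rule card_mono[rotated]) simp
    then show ?thesis by (simp only: less_Suc_eq_le)
  qed
  \<comment> \<open>The number of linked pairs is bounded by the number of all pairs of vertices, so
    a maximum over the minimum covers exists.\<close>
  obtain C where C: "?P C" and max: "\<And>D. ?P D \<Longrightarrow> card (linked_pairs D) \<le> card (linked_pairs C)"
  proof -
    obtain B where "?P B" using minimum_vertex_cover_exists by blast
    then show thesis
      using ex_has_greatest_nat[of ?P B "\<lambda>C. card (linked_pairs C)" "Suc (card (verts G \<times> verts G))"]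
        bound that by blast
  qed
  have no_swap: False if "a \<in> C" "b \<in> C" "v \<notin> C" "a \<rightarrow> v" "v \<rightarrow> b" "(a, b) \<notin> (arcs_ends G \<inter> C \<times> C)\<^sup>*"
    "\<forall>y. a \<rightarrow> y \<longrightarrow> y = v \<or> y \<rightarrow> v" for a b v
  proof -
    have "card (insert v (C - {a})) = card C"
      using card_insert_disjoint[of "C - {a}" v] card_Suc_Diff1[OF fin[OF C] that(1)] fin[OF C] that(3)
      by (metis DiffD1 finite_Diff)
    then have "?P (insert v (C - {a}))"
      using swap_vertex_cover[OF _ that(3,4,7)] C by simp
    then show False
      using max swap_linked_pairs[OF fin[OF C] that(1,2,3,4,5,7,6)] by (metis leD)
  qed
  have join: "(a, b) \<in> (arcs_ends G \<inter> C \<times> C)\<^sup>*"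
    if "a \<in> C" "b \<in> C" "v \<notin> C" "a \<rightarrow> v" "v \<rightarrow> b" for a b v
  proof (rule ccontr)
    assume sep: "(a, b) \<notin> (arcs_ends G \<inter> C \<times> C)\<^sup>*"
    then have "a \<noteq> b" "(b, a) \<notin> (arcs_ends G \<inter> C \<times> C)\<^sup>*" "(a, b) \<notin> arcs_ends G \<inter> C \<times> C"
      using sym_induced_rtrancl[of b a C] by blast+
    note sep = sep this
    have "\<not> a \<rightarrow> b" using sep(4) that by simp
    have "b \<rightarrow> v" "v \<rightarrow> a" using that adj_commute by metis+
    \<comment> \<open>Whichever of \<open>a\<close> and \<open>b\<close> is dominated by
      \<open>v\<close> is the one swapped out; hence \<open>no_swap\<close> is used once for each
      order of the two.\<close>
    from neighbourhood_dominated[OF free that(4,5) sep(2) \<open>\<not> a \<rightarrow> b\<close>] show False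
      using no_swap[OF that(1-5) sep(1)] no_swap[OF that(2,1,3) \<open>b \<rightarrow> v\<close> \<open>v \<rightarrow> a\<close> sep(3)] by argo
  qed
  have "u \<rightarrow>\<^sup>*\<^bsub>G \<restriction> C\<^esub> w" if "u \<in> C" "w \<in> C" "u \<rightarrow>\<^sup>* w" for u w
    using reachable_in_cover[OF _ that(1,3)] C join that reachable_induce_iff[OF that(1)] by metis
  with C that show thesis by metis
qed

end


section \<open>Connected vertex covers\<close>

lemma (in wf_digraph) strongly_connected_imp_connected:
  assumes "strongly_connected G"
  shows "connected G"
  using assms by (intro connectedI) (auto simp: strongly_connected_def intro: reachable_mk_symmetricI)

context graph begin

text \<open>A vertex of the cover without neighbours covers no edge and could be dropped. Thus a
  minimum cover avoids the single-vertex components.\<close>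

lemma minimum_cover_neighbour:
  assumes C: "vertex_cover G C" "card C = vc_number G" "x \<in> C"
  obtains y where "x \<rightarrow> y"
proof (rule ccontr)
  assume "\<not> thesis"
  then have "\<not> x \<rightarrow> y" "\<not> y \<rightarrow> x" for y using that adj_commute by metis+
  then have "vertex_cover G (C - {x})"
    using C(1) unfolding vertex_cover_iff by (metis Diff_iff insert_iff empty_iff subset_iff)
  then have "card C \<le> card (C - {x})" using vc_number_le C(2) by metis
  moreover have "finite C"
    using C(1) finite_subset[OF _ finite_verts] unfolding vertex_cover_iff by metis
  ultimately show False using C(3) card_Diff1_less[of C x] by simp
qed

text \<open>The components of \<open>G \<restriction> C\<close> are the nonempty traces on
  \<open>C\<close> of components of \<open>G\<close>. A component of \<open>G\<close> meets
  \<open>C\<close> exactly if it has an edge: an edge needs a vertex of the cover, and by minimality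
  a vertex of the cover has an edge.\<close>

lemma connected_vertex_cover_if_component_preserving:
  assumes C: "vertex_cover G C" "card C = vc_number G"
    and reach: "\<And>u w. \<lbrakk>u \<in> C; w \<in> C; u \<rightarrow>\<^sup>* w\<rbrakk> \<Longrightarrow> u \<rightarrow>\<^sup>*\<^bsub>G \<restriction> C\<^esub> w"
  shows "connected_vertex_cover G C"
proof -
  have sub: "C \<subseteq> verts G" using C(1) by (simp add: vertex_cover_def)
  interpret I: wf_digraph "G \<restriction> C" by (rule wellformed_induce_subgraph)
  have reach_iff: "u \<rightarrow>\<^sup>*\<^bsub>G \<restriction> C\<^esub> w \<longleftrightarrow> u \<rightarrow>\<^sup>* w \<and> u \<in> C \<and> w \<in> C" for u w
    using reach reachable_induce_subgraphD[OF _ sub] I.reachable_in_verts by (metis induce_subgraph_verts)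
  have "C = {} \<or> connected (G \<restriction> C)" if "connected G"
  proof -
    have "strongly_connected G"
      using symmetric_connected_imp_strongly_connected[OF sym_arcs that] .
    then have "u \<rightarrow>\<^sup>* w" if "u \<in> C" "w \<in> C" for u w
      using that sub unfolding strongly_connected_def by blast
    then have "strongly_connected (G \<restriction> C)" if "C \<noteq> {}"
      using that reach_iff unfolding strongly_connected_def by simp
    then show ?thesis using I.strongly_connected_imp_connected by metis
  qed
  moreover have "card I.sccs = card {K \<in> sccs. arcs K \<noteq> {}}"
  proof -
    have nontrivial: "verts ` {K \<in> sccs. arcs K \<noteq> {}} = scc_of ` C"
    proof (intro equalityI subsetI)
      fix S assume "S \<in> verts ` {K \<in> sccs. arcs K \<noteq> {}}"
      then obtain K e where K: "K \<in> sccs" "S = verts K" "e \<in> arcs K" by blast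
      have ind: "induced_subgraph K G" using K(1) by (rule in_sccs_imp_induced)
      then have "e \<in> arcs G" "tail G e \<in> S" "head G e \<in> S"
        using K(2,3) by (auto simp: induced_subgraph_def)
      moreover from this have "tail G e \<in> C \<or> head G e \<in> C"
        using C(1) by (simp add: vertex_cover_def)
      ultimately obtain x where "x \<in> S" "x \<in> C" by blast
      moreover have "S \<in> sccs_verts" using K(1,2) sccs_verts_conv by blast
      ultimately have "S = scc_of x"
        using sccs_verts_disjoint[OF _ scc_of_in_sccs_verts] in_scc_of_self sub by blast
      with \<open>x \<in> C\<close> show "S \<in> scc_of ` C" by blast
    next
      fix S assume "S \<in> scc_of ` C"
      then obtain x where x: "x \<in> C" "S = scc_of x" by blast
      obtain y where y: "x \<rightarrow> y" using minimum_cover_neighbour[OF C x(1)] .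
      then obtain e where e: "e \<in> arcs G" "tail G e = x" "head G e = y" by (rule reachableE)
      have "x \<in> verts G" using x(1) sub by blast
      then have "x \<in> S" "S \<in> sccs_verts" using x(2) in_scc_of_self scc_of_in_sccs_verts by metis+
      moreover have "y \<in> S"
        using y x(2) by (simp add: scc_ofI_reachable')
      ultimately have "G \<restriction> S \<in> {K \<in> sccs. arcs K \<noteq> {}}"
        using e in_verts_sccsD_sccs by auto
      then show "S \<in> verts ` {K \<in> sccs. arcs K \<noteq> {}}"
        by (rule rev_image_eqI) simp
    qed
    have "card {K \<in> sccs. arcs K \<noteq> {}} = card (verts ` {K \<in> sccs. arcs K \<noteq> {}})"
      by (rule card_image[symmetric]) (rule inj_on_subset[OF inj_on_verts_sccs], blast)
    also have "\<dots> = card (scc_of ` C)" by (simp only: nontrivial)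
    \<comment> \<open>Distinct components are disjoint, so one that meets \<open>C\<close> can be
      recovered from its trace on \<open>C\<close>.\<close>
    also have "\<dots> = card ((\<lambda>S. S \<inter> C) ` scc_of ` C)"
    proof (rule card_image[symmetric], rule inj_onI)
      fix S T assume A: "S \<in> scc_of ` C" "T \<in> scc_of ` C" "S \<inter> C = T \<inter> C"
      then obtain x where x: "x \<in> C" "S = scc_of x" by blast
      then have "x \<in> S" using in_scc_of_self sub by blast
      then have "x \<in> T" using A(3) x(1) by blast
      moreover obtain y where "T = scc_of y" using A(2) by blast
      ultimately show "S = T" using scc_of_eq x(2) by metis
    qed
    also have "(\<lambda>S. S \<inter> C) ` scc_of ` C = I.scc_of ` C"
      unfolding image_image
    proof (rule image_cong[OF refl])
      fix x assume "x \<in> C"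
      then show "scc_of x \<inter> C = I.scc_of x"
        unfolding scc_of_def I.scc_of_def using reach_iff by blast
    qed
    also have "\<dots> = I.sccs_verts" by (simp add: I.sccs_verts_conv_scc_of)
    finally show ?thesis by (simp add: I.card_sccs_verts)
  qed
  ultimately show ?thesis using C(1) by (simp add: connected_vertex_cover_def)
qed

text \<open>The given connected cover ensures that the \<open>LEAST\<close> in
  \<open>cvc_number\<close> is attained; the cover attaining it is in particular a vertex
  cover.\<close>

lemma vc_number_le_cvc_number:
  assumes "connected_vertex_cover G C"
  shows "vc_number G \<le> cvc_number G"
proof -
  have "\<exists>k D. connected_vertex_cover G D \<and> card D = k" using assms by blast
  from LeastI_ex[OF this] obtain D where "connected_vertex_cover G D" "card D = cvc_number G"
    unfolding cvc_number_def by blast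
  then show ?thesis using vc_number_le[of D] by (simp add: connected_vertex_cover_def)
qed

lemma cvc_number_eq_vc_number:
  assumes free: "\<not> contains_induced G (path_graph 5)" "\<not> contains_induced G (cycle_graph 5)"
      "\<not> contains_induced G (cycle_graph 4)"
  shows "cvc_number G = vc_number G"
proof -
  obtain C where C: "vertex_cover G C" "card C = vc_number G"
    "\<And>u w. \<lbrakk>u \<in> C; w \<in> C; u \<rightarrow>\<^sup>* w\<rbrakk> \<Longrightarrow> u \<rightarrow>\<^sup>*\<^bsub>G \<restriction> C\<^esub> w"
    using component_preserving_minimum_cover[OF free] by metis
  then have conn: "connected_vertex_cover G C"
    by (rule connected_vertex_cover_if_component_preserving)
  then have "cvc_number G \<le> card C"
    unfolding cvc_number_def by (intro Least_le) blast
  then show ?thesis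
    using vc_number_le_cvc_number[OF conn] C(2) by simp
qed

section \<open>Connected graphs whose small vertex covers have isolated vertices\<close>

text \<open>Under equality some connected cover \<open>D\<close> is minimum, hence no larger than
  the explicit cover \<open>B\<close>. Its index set \<open>A\<close> then has, by
  \<open>covers\<close>, an isolated index besides another one, so \<open>D\<close> is
  disconnected.\<close>

lemma cvc_number_neq_vc_number:
  fixes f :: "nat \<Rightarrow> 'a" and E :: "nat rel"
  assumes f: "inj_on f {..<k}" "verts G = f ` {..<k}" "0 < k"
    and adj: "\<And>i j. \<lbrakk>i < k; j < k\<rbrakk> \<Longrightarrow> f i \<rightarrow> f j \<longleftrightarrow> (i, j) \<in> E"
    and conn: "\<And>i. Suc i < k \<Longrightarrow> (i, Suc i) \<in> E"
    and B: "B \<subseteq> {..<k}" "\<And>i j. (i, j) \<in> E \<Longrightarrow> i \<in> B \<or> j \<in> B"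
    and covers: "\<And>A. \<lbrakk>A \<subseteq> {..<k}; \<And>i j. (i, j) \<in> E \<Longrightarrow> i < k \<Longrightarrow> j < k \<Longrightarrow> i \<in> A \<or> j \<in> A; card A \<le> card B\<rbrakk>
      \<Longrightarrow> \<exists>i\<in>A. \<exists>j\<in>A. i \<noteq> j \<and> (\<forall>l\<in>A. (i, l) \<notin> E)"
  shows "cvc_number G \<noteq> vc_number G"
proof
  assume eq: "cvc_number G = vc_number G"
  have reach0: "f 0 \<rightarrow>\<^sup>* f i" if "i < k" for i
    using that
  proof (induction i)
    case 0
    then show ?case using f(2) by simp
  next
    case (Suc i)
    then have "f i \<rightarrow> f (Suc i)" using adj conn by simp
    then show ?case using Suc by (metis Suc_lessD reachable_adj_trans)
  qed
  have "strongly_connected G"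
  proof
    show "verts G \<noteq> {}" using f(2,3) by (metis empty_iff image_eqI lessThan_iff)
  next
    fix u v assume "u \<in> verts G" "v \<in> verts G"
    then have "f 0 \<rightarrow>\<^sup>* u" "f 0 \<rightarrow>\<^sup>* v" using reach0 f(2) by (metis imageE lessThan_iff)+
    then show "u \<rightarrow>\<^sup>* v" using symmetric_reachable' reachable_trans by metis
  qed
  then have G: "connected G" by (rule strongly_connected_imp_connected)
  \<comment> \<open>As \<open>G\<close> is connected, its whole vertex set is a connected cover, so
    \<open>cvc_number\<close> is attained.\<close>
  have "G \<restriction> verts G = G" by (rule induce_eq_iff_induced[OF induced_subgraph_refl])
  then have "connected_vertex_cover G (verts G)"
    using G vertex_cover_verts by (simp add: connected_vertex_cover_def)
  then have "\<exists>k D. connected_vertex_cover G D \<and> card D = k" by blast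
  from LeastI_ex[OF this] obtain D where D: "connected_vertex_cover G D" "card D = cvc_number G"
    unfolding cvc_number_def by blast
  have D': "vertex_cover G D" "D = {} \<or> connected (G \<restriction> D)"
    using D(1) G by (simp_all add: connected_vertex_cover_def)
  have "vertex_cover G (f ` B)"
    unfolding vertex_cover_iff
  proof (intro conjI allI impI)
    show "f ` B \<subseteq> verts G" using B(1) f(2) by blast
  next
    fix u v assume uv: "u \<rightarrow> v"
    then have "u \<in> verts G" "v \<in> verts G" by (simp_all add: adj_in_verts)
    then obtain i j where ij: "i < k" "u = f i" "j < k" "v = f j" using f(2) by blast
    then have "i \<in> B \<or> j \<in> B" using adj uv B(2) by metis
    then show "u \<in> f ` B \<or> v \<in> f ` B" using ij by (metis imageI)
  qed
  then have "card D \<le> card (f ` B)" using vc_number_le D(2) eq by metis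
  also have "\<dots> \<le> card B" using B(1) finite_subset by (blast intro: card_image_le)
  finally have cardD: "card D \<le> card B" .
  define A where "A = {i. i < k \<and> f i \<in> D}"
  have "D \<subseteq> f ` {..<k}" using D'(1) f(2) unfolding vertex_cover_iff by simp
  then have DA: "D = f ` A" by (auto simp: A_def)
  have "A \<subseteq> {..<k}" by (auto simp: A_def)
  have "card A \<le> card B"
    using cardD card_image[OF inj_on_subset[OF f(1) \<open>A \<subseteq> {..<k}\<close>]] DA by simp
  moreover have "i \<in> A \<or> j \<in> A" if "(i, j) \<in> E" "i < k" "j < k" for i j
    using that adj[of i j] D'(1) unfolding vertex_cover_iff A_def mem_Collect_eq by metis
  ultimately obtain i j where ij: "i \<in> A" "j \<in> A" "i \<noteq> j" and iso: "\<And>l. l \<in> A \<Longrightarrow> (i, l) \<notin> E"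
    using covers[OF \<open>A \<subseteq> {..<k}\<close>] by metis
  have mem: "f i \<in> D" "f j \<in> D" and "f i \<noteq> f j"
    using ij inj_onD[OF f(1)] unfolding A_def by auto
  have "D \<subseteq> verts G" using D'(1) by (simp add: vertex_cover_iff)
  then have ind: "induced_subgraph (G \<restriction> D) G" by (rule induced_induce)
  interpret I: wf_digraph "G \<restriction> D" by (rule wellformed_induce_subgraph)
  have "connected (G \<restriction> D)" using D'(2) mem(1) by blast
  then have "strongly_connected (G \<restriction> D)"
    by (rule I.symmetric_connected_imp_strongly_connected[OF induced_graph_imp_symmetric[OF sym_arcs ind]])
  then have "f i \<rightarrow>\<^sup>*\<^bsub>G \<restriction> D\<^esub> f j"
    using mem by (simp add: strongly_connected_def)
  \<comment> \<open>A walk to a different vertex begins with an edge inside \<open>D\<close>,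
    contrary to the isolation of \<open>f i\<close>.\<close>
  then obtain w where "f i \<rightarrow>\<^bsub>G \<restriction> D\<^esub> w"
    using I.converse_reachable_cases \<open>f i \<noteq> f j\<close> by metis
  then have "f i \<rightarrow> w" "w \<in> D" by (simp_all add: arcs_ends_induce)
  then obtain l where "l \<in> A" "f i \<rightarrow> f l" using DA by blast
  then show False using iso[of l] adj[of i l] ij(1) by (simp add: A_def)
qed

text \<open>The copy of \<open>F\<close> serves as \<open>H\<close>, its vertices being indexed by
  the embedding.\<close>

lemma induced_cvc_number_neq_vc_number:
  fixes F :: "nat pair_pre_digraph"
  assumes F: "pair_wf_digraph F" "pverts F = {..<k}" "0 < k" "contains_induced G F"
    and conn: "\<And>i. Suc i < k \<Longrightarrow> (i, Suc i) \<in> parcs F"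
    and B: "B \<subseteq> {..<k}" "\<And>i j. (i, j) \<in> parcs F \<Longrightarrow> i \<in> B \<or> j \<in> B"
    and covers: "\<And>A. \<lbrakk>A \<subseteq> {..<k}; \<And>i j. (i, j) \<in> parcs F \<Longrightarrow> i < k \<Longrightarrow> j < k \<Longrightarrow> i \<in> A \<or> j \<in> A; card A \<le> card B\<rbrakk>
      \<Longrightarrow> \<exists>i\<in>A. \<exists>j\<in>A. i \<noteq> j \<and> (\<forall>l\<in>A. (i, l) \<notin> parcs F)"
  shows "\<exists>H. induced_subgraph H G \<and> cvc_number H \<noteq> vc_number H"
proof -
  obtain f where f: "inj_on f {..<k}" "f ` {..<k} \<subseteq> verts G"
    and adj: "\<And>i j. \<lbrakk>i < k; j < k\<rbrakk> \<Longrightarrow> f i \<rightarrow> f j \<longleftrightarrow> (i, j) \<in> parcs F"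
    using F(4) unfolding contains_induced_iff[OF F(1)] F(2) by blast
  let ?H = "G \<restriction> (f ` {..<k})"
  have ind: "induced_subgraph ?H G" using f(2) by (rule induced_induce)
  interpret H: graph ?H
    by (rule graph_induced_subgraph[OF _ ind]) unfold_locales
  have adjH: "f i \<rightarrow>\<^bsub>?H\<^esub> f j \<longleftrightarrow> (i, j) \<in> parcs F" if "i < k" "j < k" for i j
    using adj[OF that] that by (simp add: arcs_ends_induce)
  have "cvc_number ?H \<noteq> vc_number ?H"
    by (rule H.cvc_number_neq_vc_number[where E = "parcs F" and B = B, OF f(1) induce_subgraph_verts F(3)])
      (fact adjH conn B covers)+
  with ind show ?thesis by metis
qed

end


section \<open>Small vertex covers of the three forbidden graphs\<close>

text \<open>The only cover with at most two vertices is \<open>{1, 3}\<close>, which is independent.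
  The proof runs through all 32 subsets.\<close>

lemma path_graph_5_vertex_covers:
  assumes A: "A \<subseteq> {..<5}"
    and cover: "\<And>i j. \<lbrakk>(i, j) \<in> parcs (path_graph 5); i < 5; j < 5\<rbrakk> \<Longrightarrow> i \<in> A \<or> j \<in> A"
    and card: "card A \<le> card {1, 3::nat}"
  shows "\<exists>i\<in>A. \<exists>j\<in>A. i \<noteq> j \<and> (\<forall>l\<in>A. (i, l) \<notin> parcs (path_graph 5))"
proof -
  have cover': "0 \<in> A \<or> 1 \<in> A" "1 \<in> A \<or> 2 \<in> A" "2 \<in> A \<or> 3 \<in> A" "3 \<in> A \<or> 4 \<in> A"
    using cover by (simp_all add: path_graph_def)
  have nonadj:
    "(0, 0) \<notin> parcs (path_graph 5)" "(0, 2) \<notin> parcs (path_graph 5)"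
    "(0, 3) \<notin> parcs (path_graph 5)" "(0, 4) \<notin> parcs (path_graph 5)"
    "(1, 1) \<notin> parcs (path_graph 5)" "(1, 3) \<notin> parcs (path_graph 5)"
    "(1, 4) \<notin> parcs (path_graph 5)"
    "(2, 0) \<notin> parcs (path_graph 5)" "(2, 2) \<notin> parcs (path_graph 5)"
    "(2, 4) \<notin> parcs (path_graph 5)"
    "(3, 0) \<notin> parcs (path_graph 5)" "(3, 1) \<notin> parcs (path_graph 5)"
    "(3, 3) \<notin> parcs (path_graph 5)"
    "(4, 0) \<notin> parcs (path_graph 5)" "(4, 1) \<notin> parcs (path_graph 5)"
    "(4, 2) \<notin> parcs (path_graph 5)" "(4, 4) \<notin> parcs (path_graph 5)"
    by (simp_all add: path_graph_def)
  have "A \<in> Pow {0, 1, 2, 3, 4}" using A by (simp add: lessThan_4_5)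
  then show ?thesis
    unfolding Pow_insert Pow_empty image_insert image_empty Un_insert_left Un_empty_left insert_iff empty_iff
    by (elim disjE) (use cover' card nonadj in simp_all)
qed

text \<open>A cover with at most three vertices is the complement of two non-adjacent ones: two
  neighbours and a vertex adjacent to neither.\<close>

lemma cycle_graph_5_vertex_covers:
  assumes A: "A \<subseteq> {..<5}"
    and cover: "\<And>i j. \<lbrakk>(i, j) \<in> parcs (cycle_graph 5); i < 5; j < 5\<rbrakk> \<Longrightarrow> i \<in> A \<or> j \<in> A"
    and card: "card A \<le> card {0, 1, 3::nat}"
  shows "\<exists>i\<in>A. \<exists>j\<in>A. i \<noteq> j \<and> (\<forall>l\<in>A. (i, l) \<notin> parcs (cycle_graph 5))"
proof -
  have cover': "0 \<in> A \<or> 1 \<in> A" "1 \<in> A \<or> 2 \<in> A" "2 \<in> A \<or> 3 \<in> A" "3 \<in> A \<or> 4 \<in> A" "4 \<in> A \<or> 0 \<in> A"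
    using cover by (simp_all add: cycle_graph_def)
  have nonadj:
    "(0, 0) \<notin> parcs (cycle_graph 5)" "(0, 2) \<notin> parcs (cycle_graph 5)"
    "(0, 3) \<notin> parcs (cycle_graph 5)"
    "(1, 1) \<notin> parcs (cycle_graph 5)" "(1, 3) \<notin> parcs (cycle_graph 5)"
    "(1, 4) \<notin> parcs (cycle_graph 5)"
    "(2, 0) \<notin> parcs (cycle_graph 5)" "(2, 2) \<notin> parcs (cycle_graph 5)"
    "(2, 4) \<notin> parcs (cycle_graph 5)"
    "(3, 0) \<notin> parcs (cycle_graph 5)" "(3, 1) \<notin> parcs (cycle_graph 5)"
    "(3, 3) \<notin> parcs (cycle_graph 5)"
    "(4, 1) \<notin> parcs (cycle_graph 5)" "(4, 2) \<notin> parcs (cycle_graph 5)"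
    "(4, 4) \<notin> parcs (cycle_graph 5)"
    by (simp_all add: cycle_graph_def)
  have "A \<in> Pow {0, 1, 2, 3, 4}" using A by (simp add: lessThan_4_5)
  then show ?thesis
    unfolding Pow_insert Pow_empty image_insert image_empty Un_insert_left Un_empty_left insert_iff empty_iff
    by (elim disjE) (use cover' card nonadj in simp_all)
qed

text \<open>The covers with at most two vertices are the two pairs of opposite vertices.\<close>

lemma cycle_graph_4_vertex_covers:
  assumes A: "A \<subseteq> {..<4}"
    and cover: "\<And>i j. \<lbrakk>(i, j) \<in> parcs (cycle_graph 4); i < 4; j < 4\<rbrakk> \<Longrightarrow> i \<in> A \<or> j \<in> A"
    and card: "card A \<le> card {0, 2::nat}"
  shows "\<exists>i\<in>A. \<exists>j\<in>A. i \<noteq> j \<and> (\<forall>l\<in>A. (i, l) \<notin> parcs (cycle_graph 4))"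
proof -
  have cover': "0 \<in> A \<or> 1 \<in> A" "1 \<in> A \<or> 2 \<in> A" "2 \<in> A \<or> 3 \<in> A" "3 \<in> A \<or> 0 \<in> A"
    using cover by (simp_all add: cycle_graph_def)
  have nonadj:
    "(0, 0) \<notin> parcs (cycle_graph 4)" "(0, 2) \<notin> parcs (cycle_graph 4)"
    "(1, 1) \<notin> parcs (cycle_graph 4)" "(1, 3) \<notin> parcs (cycle_graph 4)"
    "(2, 0) \<notin> parcs (cycle_graph 4)" "(2, 2) \<notin> parcs (cycle_graph 4)"
    "(3, 1) \<notin> parcs (cycle_graph 4)" "(3, 3) \<notin> parcs (cycle_graph 4)"
    by (simp_all add: cycle_graph_def)
  have "A \<in> Pow {0, 1, 2, 3}" using A by (simp add: lessThan_4_5)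
  then show ?thesis
    unfolding Pow_insert Pow_empty image_insert image_empty Un_insert_left Un_empty_left insert_iff empty_iff
    by (elim disjE) (use cover' card nonadj in simp_all)
qed

text \<open>An induced copy of a forbidden graph would itself violate the equality. The sets
  \<open>{1, 3}\<close>, \<open>{0, 1, 3}\<close> and \<open>{0, 2}\<close> are minimum covers of
  the respective graphs and supply the size bounds.\<close>

lemma (in graph) free_if_cvc_number_eq_vc_number:
  assumes eq: "\<And>H. induced_subgraph H G \<Longrightarrow> cvc_number H = vc_number H"
  shows "\<not> contains_induced G (path_graph 5)" "\<not> contains_induced G (cycle_graph 5)"
    "\<not> contains_induced G (cycle_graph 4)"
proof -
  show "\<not> contains_induced G (path_graph 5)"
  proof
    assume F: "contains_induced G (path_graph 5)"
    have B: "i \<in> {1, 3} \<or> j \<in> {1, 3}" if "(i, j) \<in> parcs (path_graph 5)" for i j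
    proof -
      have "i \<in> {0, 1, 2, 3, 4}" "j \<in> {0, 1, 2, 3, 4}"
        unfolding lessThan_4_5[symmetric] using that by (simp_all add: path_graph_def)
      then show ?thesis using that by (auto simp: path_graph_def)
    qed
    have "\<exists>H. induced_subgraph H G \<and> cvc_number H \<noteq> vc_number H"
      by (rule induced_cvc_number_neq_vc_number[where k = 5, OF pair_wf_digraph_path_graph _ _ F _ _ B])
        ((fact path_graph_5_vertex_covers | simp add: path_graph_def)+)
    then show False using eq by metis
  qed
  show "\<not> contains_induced G (cycle_graph 5)"
  proof
    assume F: "contains_induced G (cycle_graph 5)"
    have B: "i \<in> {0, 1, 3} \<or> j \<in> {0, 1, 3}" if "(i, j) \<in> parcs (cycle_graph 5)" for i j
    proof -
      have "i \<in> {0, 1, 2, 3, 4}" "j \<in> {0, 1, 2, 3, 4}"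
        unfolding lessThan_4_5[symmetric] using that by (simp_all add: cycle_graph_def)
      then show ?thesis using that by (auto simp: cycle_graph_def)
    qed
    have "\<exists>H. induced_subgraph H G \<and> cvc_number H \<noteq> vc_number H"
      by (rule induced_cvc_number_neq_vc_number[where k = 5, OF pair_wf_digraph_cycle_graph _ _ F _ _ B])
        ((fact cycle_graph_5_vertex_covers | simp add: cycle_graph_def)+)
    then show False using eq by metis
  qed
  show "\<not> contains_induced G (cycle_graph 4)"
  proof
    assume F: "contains_induced G (cycle_graph 4)"
    have B: "i \<in> {0, 2} \<or> j \<in> {0, 2}" if "(i, j) \<in> parcs (cycle_graph 4)" for i j
    proof -
      have "i \<in> {0, 1, 2, 3}" "j \<in> {0, 1, 2, 3}"
        unfolding lessThan_4_5[symmetric] using that by (simp_all add: cycle_graph_def)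
      then show ?thesis using that by (auto simp: cycle_graph_def)
    qed
    have "\<exists>H. induced_subgraph H G \<and> cvc_number H \<noteq> vc_number H"
      by (rule induced_cvc_number_neq_vc_number[where k = 4, OF pair_wf_digraph_cycle_graph _ _ F _ _ B])
        ((fact cycle_graph_4_vertex_covers | simp add: cycle_graph_def)+)
    then show False using eq by metis
  qed
qed

theorem theorem2:
  fixes G :: "('a, 'b) pre_digraph"
  assumes "graph G"
  shows "((\<forall>H. induced_subgraph H G \<longrightarrow> cvc_number H = vc_number H) \<longleftrightarrow>
          (\<not> contains_induced G (path_graph 5) \<and> \<not> contains_induced G (cycle_graph 5)
             \<and> \<not> contains_induced G (cycle_graph 4))) \<and>
         ((\<not> contains_induced G (path_graph 5) \<and> \<not> contains_induced G (cycle_graph 5)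
             \<and> \<not> contains_induced G (cycle_graph 4)) \<longleftrightarrow>
          (chordal G \<and> \<not> contains_induced G (path_graph 5)))"
proof -
  interpret graph G by fact
  \<comment> \<open>Freeness is inherited by induced subgraphs, so the equality for free graphs
    applies to each \<open>H\<close>.\<close>
  have "cvc_number H = vc_number H"
    if "induced_subgraph H G" "\<not> contains_induced G (path_graph 5)"
      "\<not> contains_induced G (cycle_graph 5)" "\<not> contains_induced G (cycle_graph 4)" for H
    using graph.cvc_number_eq_vc_number[OF graph_induced_subgraph[OF assms that(1)]]
      contains_induced_subgraph[OF _ that(1)] that(2-4) by metis
  moreover have "\<not> contains_induced G (cycle_graph 5)" "\<not> contains_induced G (cycle_graph 4)"
    if "chordal G"
    using not_chordal_if_contains_cycle_graph[of 5] not_chordal_if_contains_cycle_graph[of 4] that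
    by auto
  ultimately show ?thesis
    using free_if_cvc_number_eq_vc_number chordal_if_free by metis
qed

end
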